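(* $S(3,4) = \mathbb{N}_0 \setminus \left([1,7] \cup [9,11] \cup \{13\}\right)$, where $[a,b] = \{a, a+1, \dots, b\}$ for integers $a<b$.
   Context: Let $t \le k$ and $v$ be positive integers, $V = \{1,\dots,v\}$, and let $V^k$ be the set of ordered $k$-tuples of elements of $V$. For a $t$-subset $I = \{i_1 < \cdots < i_t\}$ of $\{1,\dots,k\}$ and $(u_1,\dots,u_t) \in V^t$, the tuple $(x_1,\dots,x_k) \in V^k$ is said to contain $(u_1,\dots,u_t)_I$ if $x_{i_j} = u_j$ for all $j = 1,\dots,t$. A $t$-$(v,k)$ Latin trade of volume $s$ is a pair $T = (T_1,T_2)$ of disjoint collections (finite multisets, i.e. repeated elements are allowed; disjoint means no tuple occurs in both), each consisting of $s$ elements of $V^k$ counted with multiplicity, such that for each $t$-subset $I \subseteq \{1,\dots,k\}$ and each $(u_1,\dots,u_t) \in V^t$, the number of elements (with multiplicity) of $T_1$ containing $(u_1,\dots,u_t)_I$ equals the number of elements of $T_2$ containing $(u_1,\dots,u_t)_I$. The trade with $T_1 = T_2 = \emptyset$ (volume $0$) is allowed. The spectrum $S(t,k)$ is the set of all integers $s$ for which there exists, for some $v$, a $t$-$(v,k)$ Latin trade of volume $s$. $\mathbb{N}_0$ denotes the nonnegative integers. *)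

theory Defs
  imports Main "HOL-Library.Multiset"
begin

(* A k-tuple (x_1, ..., x_k) is the list x with x ! (i - 1) = x_i. Positions are thus
   numbered from 0, and a t-subset I is a subset of {..<k}; symbols are 1, ..., v. *)
definition tuples :: "nat \<Rightarrow> nat \<Rightarrow> nat list set" where
  "tuples v k = {x. length x = k \<and> set x \<subseteq> {1..v}}"

definition contains_at :: "nat set \<Rightarrow> nat list \<Rightarrow> nat list \<Rightarrow> bool" where
  "contains_at I u x \<longleftrightarrow> (\<forall>j < length u. x ! (sorted_list_of_set I ! j) = u ! j)"

definition latin_trade ::
  "nat \<Rightarrow> nat \<Rightarrow> nat \<Rightarrow> nat \<Rightarrow> nat list multiset \<Rightarrow> nat list multiset \<Rightarrow> bool" where
  "latin_trade t v k s T1 T2 \<longleftrightarrow>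
     set_mset T1 \<subseteq> tuples v k \<and> set_mset T2 \<subseteq> tuples v k \<and>
     set_mset T1 \<inter> set_mset T2 = {} \<and>
     size T1 = s \<and> size T2 = s \<and>
     (\<forall>I u. I \<subseteq> {..<k} \<and> card I = t \<and> u \<in> tuples v t \<longrightarrow>
        size (filter_mset (contains_at I u) T1) = size (filter_mset (contains_at I u) T2))"

definition spectrum :: "nat \<Rightarrow> nat \<Rightarrow> nat set" where
  "spectrum t k = {s. \<exists>v T1 T2. v \<ge> 1 \<and> latin_trade t v k s T1 T2}"

end

theory Submission
  imports Defs
begin

text \<open>
  A \<open>k\<close>-\<open>(v,k+1)\<close> Latin trade is a pair of disjoint multisets of words that agree after deleting any
  one position. Slicing by the first letter decomposes a trade into trades of dimension one lower
  whose signed sum vanishes. If just two slices are nonempty they are opposite, so the volume is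
  twice a volume of the lower dimension; otherwise it is a sum of at least three such volumes.
  Iterating this from dimension 1 leaves only volumes \<open>\<ge> 2\<close>, then \<open>4\<close> and \<open>\<ge> 6\<close>, and finally
  \<open>8\<close>, \<open>12\<close> and \<open>\<ge> 14\<close>. Conversely, sums of up to three elementary cubes (tensor products of
  differences of two letters) realise \<open>8\<close>, \<open>12\<close> and \<open>14, \<dots>, 21\<close>, and volumes are closed under
  addition since trades over disjoint alphabets can be united.
\<close>

section \<open>Deletion of one position and balanced pairs\<close>

definition del :: "nat \<Rightarrow> 'a list \<Rightarrow> 'a list" where
  "del i x = take i x @ drop (Suc i) x"

text \<open>Disjointness is left out so that pairs can be added freely;
  \<open>balanced_cancel\<close> restores it afterwards.\<close>

definition balanced :: "nat \<Rightarrow> 'a list multiset \<Rightarrow> 'a list multiset \<Rightarrow> bool" where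
  "balanced k A B \<longleftrightarrow> (\<forall>x \<in># A + B. length x = k) \<and>
     (\<forall>i<k. image_mset (del i) A = image_mset (del i) B)"

text \<open>The alphabet is unbounded, as the spectrum ranges over all \<open>v\<close>; a finite
  multiset of words uses finitely many letters anyway.\<close>

definition volumes :: "nat \<Rightarrow> nat set" where
  "volumes k = {size A | A B :: nat list multiset. balanced k A B \<and> set_mset A \<inter> set_mset B = {}}"

lemma del_0: "del 0 = tl"
  by (auto simp: del_def drop_Suc)

lemma del_Suc_Cons: "del (Suc i) (a # x) = a # del i x"
  by (simp add: del_def)

lemma length_del: "i < length x \<Longrightarrow> length (del i x) = length x - 1"
  by (simp add: del_def)

lemma set_del_subset: "set (del i x) \<subseteq> set x"
  by (auto simp: del_def dest: in_set_takeD in_set_dropD)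

lemma map_del: "map f (del i x) = del i (map f x)"
  by (simp add: del_def take_map drop_map)

lemma balanced_length: "balanced k A B \<Longrightarrow> x \<in># A + B \<Longrightarrow> length x = k"
  by (auto simp: balanced_def)

lemma balanced_size_eq:
  assumes "balanced k A B" "0 < k"
  shows "size A = size B"
  using assms unfolding balanced_def by (metis size_image_mset)

lemma balanced_map:
  assumes "balanced k A B"
  shows "balanced k (image_mset (map f) A) (image_mset (map f) B)"
proof -
  have *: "image_mset (del i) (image_mset (map f) C) = image_mset (map f) (image_mset (del i) C)"
    for i C
    by (simp add: multiset.map_comp comp_def map_del)
  show ?thesis
    using assms by (auto simp: balanced_def *)
qed

lemma balanced_add:
  assumes "balanced k A B" "balanced k C D"
  shows "balanced k (A + C) (B + D)"
  using assms by (auto simp: balanced_def)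

text \<open>The common part \<open>A \<inter># B\<close> contributes the same multiset to both
  deletion images and can be subtracted.\<close>

lemma balanced_cancel:
  assumes "balanced k A B"
  shows "balanced k (A - B) (B - A)"
proof -
  have "image_mset (del i) (A - B) = image_mset (del i) (B - A)" if "i < k" for i
  proof -
    have "A - B + A \<inter># B = A" "B - A + A \<inter># B = B"
      by (auto simp: multiset_eq_iff)
    then have "image_mset (del i) (A - B) + image_mset (del i) (A \<inter># B) =
        image_mset (del i) (B - A) + image_mset (del i) (A \<inter># B)"
      using assms that by (metis balanced_def image_mset_union)
    then show ?thesis by simp
  qed
  then show ?thesis
    using assms by (auto simp: balanced_def dest: in_diffD)
qed

lemma size_diff_in_volumes:
  fixes A B :: "nat list multiset"
  assumes "balanced k A B"
  shows "size (A - B) \<in> volumes k"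
proof -
  have "set_mset (A - B) \<inter> set_mset (B - A) = {}"
    by (auto simp flip: count_greater_zero_iff)
  then show ?thesis
    using balanced_cancel[OF assms] unfolding volumes_def by blast
qed

subsection \<open>Latin trades as balanced pairs\<close>

lemma sorted_list_of_atMost_minus:
  assumes "i \<le> k"
  shows "sorted_list_of_set ({..k} - {i}) = map (\<lambda>j. if j < i then j else Suc j) [0..<k]"
    (is "_ = map ?h _")
proof -
  have "l \<in> ?h ` {0..<k}" if "l \<le> k" "l \<noteq> i" for l
  proof (cases "l < i")
    case True
    then have "l = ?h l" "l \<in> {0..<k}" using assms by auto
    then show ?thesis by blast
  next
    case False
    then have "l = ?h (l - 1)" "l - 1 \<in> {0..<k}" using that by auto
    then show ?thesis by blast
  qed
  then have "{..k} - {i} \<subseteq> ?h ` {0..<k}" by blast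
  moreover have "?h ` {0..<k} \<subseteq> {..k} - {i}" by auto
  ultimately have "set (map ?h [0..<k]) = {..k} - {i}"
    unfolding set_map set_upt by (intro equalityI)
  moreover have "sorted_wrt (<) (map ?h [0..<k])"
    by (auto simp: sorted_wrt_iff_nth_less)
  ultimately show ?thesis
    using assms sorted_list_of_set_unique[of "{..k} - {i}" "map ?h [0..<k]"] by simp
qed

lemma contains_at_iff_del:
  assumes "i \<le> k" "length x = Suc k" "length u = k"
  shows "contains_at ({..k} - {i}) u x \<longleftrightarrow> del i x = u"
proof -
  have "del i x ! j = x ! (if j < i then j else Suc j)" if "j < k" for j
    using that assms by (auto simp: del_def nth_append)
  then show ?thesis
    using assms
    by (auto simp: contains_at_def sorted_list_of_atMost_minus list_eq_iff_nth_eq length_del)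
qed

lemma size_filter_contains_at:
  assumes "\<forall>x \<in># A. length x = Suc k" "i \<le> k" "length u = k"
  shows "size (filter_mset (contains_at ({..k} - {i}) u) A) = count (image_mset (del i) A) u"
proof -
  have "filter_mset (contains_at ({..k} - {i}) u) A = filter_mset (\<lambda>x. u = del i x) A"
    using assms by (intro filter_mset_cong) (auto simp: contains_at_iff_del)
  then show ?thesis
    by (simp add: count_image_mset' size_multiset_overloaded_eq flip: count_conv_size_mset)
qed

text \<open>The \<open>k\<close>-subsets of \<open>k + 1\<close> positions are the complements of
  single positions, and containing \<open>u\<close> there means that deletion leaves
  \<open>u\<close>. So the trade condition compares multiplicities in the deletion images.\<close>

lemma latin_trade_iff_balanced:
  "latin_trade k v (Suc k) s A B \<longleftrightarrow>
     set_mset A \<subseteq> tuples v (Suc k) \<and> set_mset B \<subseteq> tuples v (Suc k) \<and>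
     set_mset A \<inter> set_mset B = {} \<and> size A = s \<and> balanced (Suc k) A B"
proof (cases "set_mset A \<subseteq> tuples v (Suc k) \<and> set_mset B \<subseteq> tuples v (Suc k)")
  case True
  then have len: "\<forall>x \<in># A. length x = Suc k" "\<forall>x \<in># B. length x = Suc k"
    and sub: "\<forall>x \<in># A. set x \<subseteq> {1..v}" "\<forall>x \<in># B. set x \<subseteq> {1..v}"
    by (auto simp: tuples_def)
  have idx: "I \<subseteq> {..<Suc k} \<and> card I = k \<longleftrightarrow> (\<exists>i\<le>k. I = {..k} - {i})" for I
  proof
    assume I: "I \<subseteq> {..<Suc k} \<and> card I = k"
    then have "card ({..k} - I) = 1"
      by (subst card_Diff_subset) (auto intro: finite_subset simp: lessThan_Suc_atMost)
    then obtain i where i: "{..k} - I = {i}"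
      by (auto simp: card_Suc_eq)
    then show "\<exists>i\<le>k. I = {..k} - {i}"
      using I by (intro exI[of _ i]) (auto simp: lessThan_Suc_atMost)
  qed auto
  \<comment> \<open>Trades only test words \<open>u\<close> over \<open>{1..v}\<close>; any other
    word has multiplicity 0 in both images, so these agree as multisets.\<close>
  have out: "count (image_mset (del i) C) u = 0"
    if "\<forall>x \<in># C. length x = Suc k" "\<forall>x \<in># C. set x \<subseteq> {1..v}" "i \<le> k" "u \<notin> tuples v k"
    for i C u
  proof -
    have "del i x \<in> tuples v k" if "x \<in># C" for x
      using that \<open>i \<le> k\<close> \<open>\<forall>x \<in># C. length x = Suc k\<close> \<open>\<forall>x \<in># C. set x \<subseteq> {1..v}\<close>
        set_del_subset[of i x]
      by (fastforce simp: tuples_def length_del)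
    then show ?thesis
      using that(4) by (auto simp: count_eq_zero_iff)
  qed
  have "(\<forall>I u. I \<subseteq> {..<Suc k} \<and> card I = k \<and> u \<in> tuples v k \<longrightarrow>
        size (filter_mset (contains_at I u) A) = size (filter_mset (contains_at I u) B)) \<longleftrightarrow>
      (\<forall>i\<le>k. \<forall>u \<in> tuples v k. count (image_mset (del i) A) u = count (image_mset (del i) B) u)"
    (is "?L \<longleftrightarrow> ?R")
  proof -
    have "?L \<longleftrightarrow> (\<forall>i\<le>k. \<forall>u \<in> tuples v k.
        size (filter_mset (contains_at ({..k} - {i}) u) A) =
        size (filter_mset (contains_at ({..k} - {i}) u) B))"
      unfolding conj_assoc[symmetric] idx by blast
    also have "\<dots> \<longleftrightarrow> ?R"
      using len by (auto simp: size_filter_contains_at tuples_def)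
    finally show ?thesis .
  qed
  also have "\<dots> \<longleftrightarrow> (\<forall>i\<le>k. image_mset (del i) A = image_mset (del i) B)"
    unfolding multiset_eq_iff using out[OF len(1) sub(1)] out[OF len(2) sub(2)] by metis
  also have "\<dots> \<longleftrightarrow> balanced (Suc k) A B"
    using len by (auto simp: balanced_def less_Suc_eq_le)
  finally show ?thesis
    using True balanced_size_eq[of "Suc k" A B] unfolding latin_trade_def by auto
qed (auto simp: latin_trade_def)

lemma spectrum_eq_volumes: "spectrum k (Suc k) = volumes (Suc k)"
proof
  show "spectrum k (Suc k) \<subseteq> volumes (Suc k)"
    by (auto simp: spectrum_def volumes_def latin_trade_iff_balanced)
  show "volumes (Suc k) \<subseteq> spectrum k (Suc k)"
  proof
    fix s assume "s \<in> volumes (Suc k)"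
    then obtain A B :: "nat list multiset"
      where AB: "balanced (Suc k) A B" "set_mset A \<inter> set_mset B = {}" "size A = s"
      by (auto simp: volumes_def)
    \<comment> \<open>Letters of a trade start at 1, hence the shift by \<open>Suc\<close>.\<close>
    let ?A = "image_mset (map Suc) A" and ?B = "image_mset (map Suc) B"
    have "finite (\<Union>x \<in> set_mset (A + B). set x)" by simp
    then obtain m where m: "\<forall>a \<in> (\<Union>x \<in> set_mset (A + B). set x). a \<le> m"
      using finite_nat_set_iff_bounded_le by blast
    have "set_mset ?A \<subseteq> tuples (Suc m) (Suc k)" "set_mset ?B \<subseteq> tuples (Suc m) (Suc k)"
      using m AB(1) by (fastforce simp: tuples_def balanced_def)+
    moreover have "set_mset ?A \<inter> set_mset ?B = {}"
      using AB(2) by (auto dest!: map_injective)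
    ultimately have "latin_trade k (Suc m) (Suc k) s ?A ?B"
      using AB balanced_map by (auto simp: latin_trade_iff_balanced)
    then show "s \<in> spectrum k (Suc k)"
      unfolding spectrum_def by fastforce
  qed
qed

section \<open>Closure of volumes under addition\<close>

lemma volumes_add:
  assumes "s \<in> volumes k" "t \<in> volumes k" "0 < k"
  shows "s + t \<in> volumes k"
proof -
  obtain A B C D :: "nat list multiset"
    where AB: "balanced k A B" "set_mset A \<inter> set_mset B = {}" "size A = s"
      and CD: "balanced k C D" "set_mset C \<inter> set_mset D = {}" "size C = t"
    using assms unfolding volumes_def by blast
  \<comment> \<open>Even and odd letters are two disjoint copies of the alphabet; words of positive
    length over them differ in the first letter.\<close>
  let ?e = "map (\<lambda>a::nat. 2 * a)" and ?o = "map (\<lambda>a::nat. Suc (2 * a))"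
  have inj: "inj ?e" "inj ?o"
    by (auto intro!: list.inj_map injI)
  have ne: "?e x \<noteq> ?o y" if len: "length x = k" for x y
  proof
    assume eq: "?e x = ?o y"
    obtain a x' where "x = a # x'" using \<open>0 < k\<close> len by (cases x) auto
    with eq show False by (cases y) (auto, presburger)
  qed
  let ?P = "image_mset ?e A + image_mset ?o C" and ?M = "image_mset ?e B + image_mset ?o D"
  have "balanced k ?P ?M"
    using AB(1) CD(1) by (intro balanced_add balanced_map)
  moreover have "set_mset ?P \<inter> set_mset ?M = {}"
  proof -
    have "?e ` set_mset A \<inter> ?e ` set_mset B = {}" "?o ` set_mset C \<inter> ?o ` set_mset D = {}"
      by (simp_all add: AB(2) CD(2) flip: image_Int[OF inj(1)] image_Int[OF inj(2)])
    moreover have "?e ` X \<inter> ?o ` Y = {}" if "\<forall>x\<in>X. length x = k" for X Y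
    proof (rule equals0I)
      fix z assume "z \<in> ?e ` X \<inter> ?o ` Y"
      then obtain x y where "x \<in> X" "?e x = ?o y" by (elim IntE imageE) metis
      then show False using that ne by metis
    qed
    then have "?e ` set_mset A \<inter> ?o ` set_mset D = {}" "?o ` set_mset C \<inter> ?e ` set_mset B = {}"
      using balanced_length[OF AB(1)] by (simp_all add: Int_commute)
    ultimately show ?thesis
      by (simp add: Int_Un_distrib Int_Un_distrib2)
  qed
  ultimately show ?thesis
    using AB(3) CD(3) unfolding volumes_def
    by (intro CollectI exI[of _ ?P] exI[of _ ?M] conjI) simp_all
qed

subsection \<open>Slicing by the first letter\<close>

definition layer :: "'a \<Rightarrow> 'a list multiset \<Rightarrow> 'a list multiset" where
  "layer a A = image_mset tl (filter_mset (\<lambda>x. hd x = a) A)"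

lemma in_layer_iff:
  assumes "\<forall>x \<in># A. x \<noteq> []"
  shows "y \<in># layer a A \<longleftrightarrow> a # y \<in># A"
  using assms by (force simp: layer_def)

text \<open>Deleting a later position keeps the first letter, so it commutes with slicing up to an
  index shift by one.\<close>

lemma balanced_layer:
  assumes "balanced (Suc k) A B"
  shows "balanced k (layer a A) (layer a B)"
proof -
  have "image_mset (del i) (layer a C) = layer a (image_mset (del (Suc i)) C)"
    if "\<forall>x \<in># C. length x = Suc k" for i C
    using that
  proof (induction C)
    case (add x C)
    then show ?case by (cases x) (auto simp: layer_def del_Suc_Cons)
  qed (simp add: layer_def)
  then show ?thesis
    using assms by (auto simp: balanced_def) (auto simp: layer_def)
qed

lemma sum_layers:
  assumes "finite S" "hd ` set_mset A \<subseteq> S"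
  shows "(\<Sum>a\<in>S. layer a A) = image_mset tl A"
  using assms(2)
proof (induction A)
  case (add x A)
  have "layer a (add_mset x A) = (if hd x = a then {#tl x#} else {#}) + layer a A" for a
    by (simp add: layer_def)
  then show ?case
    using add assms(1) by (simp add: sum.distrib)
qed (simp add: layer_def)

lemma sum_closed:
  fixes f :: "'a \<Rightarrow> nat"
  assumes "finite S" "S \<noteq> {}" "\<And>a. a \<in> S \<Longrightarrow> Q (f a)" "\<And>m n. Q m \<Longrightarrow> Q n \<Longrightarrow> Q (m + n)"
  shows "Q (sum f S)"
  using assms(1-3) by (induction S rule: finite_ne_induct) (auto intro: assms(4))

text \<open>Each nonempty slice has a nonzero volume of dimension \<open>k\<close>. Additive closure
  of \<open>Q\<close> lets all slices beyond the first two be merged into one summand, so three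
  terms suffice.\<close>

lemma volumes_Suc_cases:
  assumes s: "s \<in> volumes (Suc k)" "s \<noteq> 0" and "0 < k"
    and Q: "\<And>m. m \<in> volumes k \<Longrightarrow> m \<noteq> 0 \<Longrightarrow> Q m"
    and Q_add: "\<And>m n. Q m \<Longrightarrow> Q n \<Longrightarrow> Q (m + n)"
  obtains m where "Q m" "s = 2 * m"
  | l m n where "Q l" "Q m" "Q n" "s = l + m + n"
proof -
  obtain A B :: "nat list multiset"
    where AB: "balanced (Suc k) A B" "set_mset A \<inter> set_mset B = {}" "size A = s"
    using s by (auto simp: volumes_def)
  have nonempty: "\<forall>x \<in># A. x \<noteq> []" "\<forall>x \<in># B. x \<noteq> []"
    using balanced_length[OF AB(1)] by (metis Zero_not_Suc list.size(3) union_iff)+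
  have disj: "set_mset (layer a A) \<inter> set_mset (layer a B) = {}" for a
    using AB(2) by (auto simp: in_layer_iff[OF nonempty(1)] in_layer_iff[OF nonempty(2)])
  have same_size: "size (layer a A) = size (layer a B)" for a
    using balanced_size_eq[OF balanced_layer[OF AB(1)] \<open>0 < k\<close>] .
  define S where "S = hd ` (set_mset A \<union> set_mset B)"
  define L where "L = {a \<in> S. layer a A \<noteq> {#}}"
  have "finite S" by (simp add: S_def)
  then have "finite L" by (simp add: L_def)
  have empty: "layer a A = {#} \<and> layer a B = {#}" if "a \<in> S - L" for a
    using that same_size[of a] by (auto simp: L_def)
  have "(\<Sum>a\<in>L. layer a A) = (\<Sum>a\<in>S. layer a A)" "(\<Sum>a\<in>L. layer a B) = (\<Sum>a\<in>S. layer a B)"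
    using \<open>finite S\<close> empty by (auto intro!: sum.mono_neutral_left simp: L_def)
  then have sumA: "(\<Sum>a\<in>L. layer a A) = image_mset tl A"
    and sumB: "(\<Sum>a\<in>L. layer a B) = image_mset tl B"
    using sum_layers[OF \<open>finite S\<close>] by (simp_all add: S_def image_Un)
  moreover have "image_mset tl A = image_mset tl B"
    using AB(1) by (auto simp: balanced_def simp flip: del_0)
  ultimately have sum_eq: "(\<Sum>a\<in>L. layer a A) = (\<Sum>a\<in>L. layer a B)" by simp
  have s_eq: "s = (\<Sum>a\<in>L. size (layer a A))"
    using arg_cong[OF sumA, of size] AB(3) by (simp add: size_multiset_sum)
  have QL: "Q (size (layer a A))" if "a \<in> L" for a
    using that Q balanced_layer[OF AB(1), of a] disj[of a] by (auto simp: volumes_def L_def)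
  obtain a where a: "a \<in> L"
    using s_eq s(2) by fastforce
  \<comment> \<open>A single slice would have equal components, yet these are disjoint and not
    empty.\<close>
  have "L \<noteq> {a}"
    using a disj[of a] sum_eq by (auto simp: L_def)
  then obtain b where b: "b \<in> L" "b \<noteq> a"
    using a by auto
  have L: "L = insert a (insert b (L - {a, b}))"
    using a b by auto
  show ?thesis
  proof (cases "L - {a, b} = {}")
    case True
    then have L: "L = {a, b}" using a b by blast
    have eq: "layer a A + layer b A = layer a B + layer b B"
      using sum_eq b by (simp add: L)
    \<comment> \<open>At each word at most one component of either slice is nonzero, which leaves
      only cancellation across the two slices.\<close>
    have "layer a A = layer b B"
    proof (rule multiset_eqI)
      fix x
      have "count (layer a A) x = 0 \<or> count (layer a B) x = 0"
        "count (layer b A) x = 0 \<or> count (layer b B) x = 0"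
        using disj by (auto simp: count_eq_zero_iff)
      moreover have "count (layer a A) x + count (layer b A) x =
          count (layer a B) x + count (layer b B) x"
        using arg_cong[OF eq, of "\<lambda>M. count M x"] by simp
      ultimately show "count (layer a A) x = count (layer b B) x" by auto
    qed
    then have "s = 2 * size (layer a A)"
      using s_eq b same_size[of b] by (simp add: L)
    then show ?thesis using that(1) QL[OF a] by blast
  next
    case False
    have "s = size (layer a A) + size (layer b A) + (\<Sum>c\<in>L - {a, b}. size (layer c A))"
      unfolding s_eq using \<open>finite L\<close> b by (subst L) simp
    moreover have "Q (\<Sum>c\<in>L - {a, b}. size (layer c A))"
      using False \<open>finite L\<close> QL Q_add by (intro sum_closed[where Q = Q]) blast+
    ultimately show ?thesis using that(2) QL a b by blast
  qed
qed

section \<open>Excluded volumes, dimension by dimension\<close>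

lemma volumes_2:
  assumes "s \<in> volumes 2" "s \<noteq> 0"
  shows "2 \<le> s"
proof -
  have "s \<in> volumes (Suc 1)" using assms by (simp add: numeral_2_eq_2)
  then show ?thesis
    using assms(2) by (cases rule: volumes_Suc_cases[of s 1 "\<lambda>m. 1 \<le> m"]) auto
qed

lemma volumes_3:
  assumes "s \<in> volumes 3" "s \<noteq> 0"
  shows "s = 4 \<or> 6 \<le> s"
proof -
  have "s \<in> volumes (Suc 2)" using assms by simp
  then show ?thesis
    using assms(2) by (cases rule: volumes_Suc_cases[of s 2 "\<lambda>m. 2 \<le> m"]) (auto dest: volumes_2)
qed

text \<open>Doubling 4 gives 8, and doubling 6 or more gives 12 or at least 14. Three terms give 4 +
  4 + 4 = 12 or at least 4 + 4 + 6 = 14. Hence 13 is missed.\<close>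

lemma volumes_4:
  assumes "s \<in> volumes 4" "s \<noteq> 0"
  shows "s = 8 \<or> s = 12 \<or> 14 \<le> s"
proof -
  have "s \<in> volumes (Suc 3)" using assms by simp
  then show ?thesis
    using assms(2)
    by (cases rule: volumes_Suc_cases[of s 3 "\<lambda>m. m = 4 \<or> 6 \<le> m"]) (auto dest: volumes_3)
qed

subsection \<open>Elementary cubes\<close>

text \<open>Expanding \<open>(a\<^sub>1 - b\<^sub>1) \<otimes> \<dots> \<otimes> (a\<^sub>k - b\<^sub>k)\<close>, the words with positive sign form the first
  component and those with negative sign the second.\<close>

fun cube :: "('a \<times> 'a) list \<Rightarrow> 'a list multiset \<times> 'a list multiset" where
  "cube [] = ({#[]#}, {#})"
| "cube ((a, b) # ps) = (case cube ps of (P, N) \<Rightarrow>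
     (image_mset ((#) a) P + image_mset ((#) b) N, image_mset ((#) a) N + image_mset ((#) b) P))"

text \<open>Deleting the first letter turns both components into \<open>P + N\<close>; later
  positions follow by induction.\<close>

lemma balanced_cube: "balanced (length ps) (fst (cube ps)) (snd (cube ps))"
proof (induction ps)
  case Nil
  then show ?case by (simp add: balanced_def)
next
  case (Cons p ps)
  obtain a b P N where [simp]: "p = (a, b)" "cube ps = (P, N)"
    by (metis surj_pair)
  have IH: "balanced (length ps) P N" using Cons by simp
  have step: "image_mset (del (Suc i)) (image_mset ((#) c) C) =
      image_mset ((#) c) (image_mset (del i) C)" for i c and C :: "'a list multiset"
    by (simp add: multiset.map_comp comp_def del_Suc_Cons)
  have zero: "image_mset (del 0) (image_mset ((#) c) C) = C" for c and C :: "'a list multiset"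
    by (simp add: multiset.map_comp comp_def del_0)
  have "image_mset (del i) (image_mset ((#) a) P + image_mset ((#) b) N) =
      image_mset (del i) (image_mset ((#) a) N + image_mset ((#) b) P)"
    if "i < Suc (length ps)" for i
    using that IH by (cases i) (simp_all add: zero step balanced_def)
  then show ?case
    using IH by (auto simp: balanced_def)
qed

lemma balanced_sum_cubes:
  assumes "\<forall>ps \<in> set pss. length ps = k"
  shows "balanced k (\<Sum>ps\<leftarrow>pss. fst (cube ps)) (\<Sum>ps\<leftarrow>pss. snd (cube ps))"
  using assms
proof (induction pss)
  case (Cons ps pss)
  then show ?case using balanced_cube[of ps] by (auto intro: balanced_add)
qed (simp add: balanced_def)

definition cubes_volume :: "('a \<times> 'a) list list \<Rightarrow> nat" where
  "cubes_volume pss = size ((\<Sum>ps\<leftarrow>pss. fst (cube ps)) - (\<Sum>ps\<leftarrow>pss. snd (cube ps)))"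

lemma cubes_volume_in_volumes:
  fixes pss :: "(nat \<times> nat) list list"
  assumes "cubes_volume pss = s" "\<forall>ps \<in> set pss. length ps = k"
  shows "s \<in> volumes k"
  using size_diff_in_volumes[OF balanced_sum_cubes[OF assms(2)]] assms(1)
  by (simp add: cubes_volume_def)

lemma volumes_4_small:
  "0 \<in> volumes 4" "8 \<in> volumes 4" "12 \<in> volumes 4" "14 \<in> volumes 4" "15 \<in> volumes 4"
  "16 \<in> volumes 4" "17 \<in> volumes 4" "18 \<in> volumes 4" "19 \<in> volumes 4" "20 \<in> volumes 4"
  "21 \<in> volumes 4"
proof -
  \<comment> \<open>A sum of \<open>n\<close> cubes has volume \<open>8 * n\<close> minus the number
    of word pairs of opposite sign that cancel. The further cubes are chosen to overlap
    \<open>?c\<close> and one another so that exactly the required number cancels.\<close>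
  let ?c = "[(0, 1), (0, 1), (0, 1), (0, 1)]"
  show "0 \<in> volumes 4"
    by (rule cubes_volume_in_volumes[of "[]"]) (code_simp, simp)
  show "8 \<in> volumes 4"
    by (rule cubes_volume_in_volumes[of "[?c]"]) (code_simp, simp)
  show "12 \<in> volumes 4"
    by (rule cubes_volume_in_volumes[of "[?c, [(1, 0), (0, 2), (2, 1), (0, 1)]]"])
       (code_simp, simp)
  show "14 \<in> volumes 4"
    by (rule cubes_volume_in_volumes[of "[?c, [(1, 2), (1, 0), (0, 2), (1, 3)]]"])
       (code_simp, simp)
  show "15 \<in> volumes 4"
    by (rule cubes_volume_in_volumes[of "[?c, [(0, 3), (0, 2), (1, 2), (0, 2)]]"])
       (code_simp, simp)
  show "16 \<in> volumes 4"
    using volumes_add[OF \<open>8 \<in> volumes 4\<close> \<open>8 \<in> volumes 4\<close>] by simp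
  show "17 \<in> volumes 4"
    by (rule cubes_volume_in_volumes[of
          "[?c, [(2, 1), (0, 2), (1, 2), (0, 2)], [(0, 1), (2, 1), (1, 2), (0, 1)]]"])
       (code_simp, simp)
  show "18 \<in> volumes 4"
    by (rule cubes_volume_in_volumes[of
          "[?c, [(0, 3), (2, 0), (0, 1), (0, 3)], [(0, 1), (0, 3), (1, 0), (2, 1)]]"])
       (code_simp, simp)
  show "19 \<in> volumes 4"
    by (rule cubes_volume_in_volumes[of
          "[?c, [(0, 3), (0, 3), (1, 2), (0, 2)], [(0, 2), (1, 0), (1, 2), (1, 2)]]"])
       (code_simp, simp)
  show "20 \<in> volumes 4"
    using volumes_add[OF \<open>8 \<in> volumes 4\<close> \<open>12 \<in> volumes 4\<close>] by simp
  show "21 \<in> volumes 4"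
    by (rule cubes_volume_in_volumes[of
          "[?c, [(1, 0), (1, 2), (1, 3), (2, 3)], [(0, 3), (1, 0), (1, 2), (1, 3)]]"])
       (code_simp, simp)
qed

lemma volumes_4_large: "14 \<le> s \<Longrightarrow> s \<in> volumes 4"
proof (induction s rule: less_induct)
  case (less s)
  show ?case
  \<comment> \<open>The range from 14 to 21 covers every residue modulo 8, so adding copies of
    volume 8 reaches everything above.\<close>
  proof (cases "s < 22")
    case True
    then have "s \<in> {14, 15, 16, 17, 18, 19, 20, 21}"
      using less.prems by auto
    then show ?thesis using volumes_4_small by auto
  next
    case False
    then have "s - 8 \<in> volumes 4" by (intro less.IH) auto
    then show ?thesis
      using volumes_add[OF _ volumes_4_small(2), of "s - 8"] False by simp
  qed
qed

theorem theorem4: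
  shows "spectrum 3 4 = (UNIV :: nat set) - ({1..7} \<union> {9..11} \<union> {13})"
proof -
  have "spectrum 3 4 = volumes 4"
    using spectrum_eq_volumes[of 3] by simp
  moreover have "s \<in> volumes 4 \<longleftrightarrow> s = 0 \<or> s = 8 \<or> s = 12 \<or> 14 \<le> s" for s
    using volumes_4[of s] volumes_4_small volumes_4_large[of s] by auto
  ultimately show ?thesis
    by auto
qed

end
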